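(* Let $c=c(\alpha,\beta)$ be any word on $\{\alpha^{\pm1},\beta^{\pm1}\}$. For any finite index subgroup $H$ of $\langle \alpha,\beta\rangle *_{\langle c\rangle}\langle\alpha',\beta'\rangle$, $H$ admits a transitive, faithful and amenable action.
   Context: Here $\langle\alpha,\beta\rangle$ and $\langle\alpha',\beta'\rangle$ are free groups of rank $2$ on the displayed generators, and $\langle \alpha,\beta\rangle *_{\langle c\rangle}\langle\alpha',\beta'\rangle$ is the amalgamated free product along the cyclic subgroups generated by $c(\alpha,\beta)$ and $c(\alpha',\beta')$, these two elements being identified; equivalently, it is the group with presentation $\langle \alpha,\beta,\alpha',\beta'\mid c(\alpha,\beta)=c(\alpha',\beta')\rangle$. An action of a group $G$ on a set $X$ is amenable if there is a $G$-invariant mean on $X$, i.e. a map $\mu:\mathcal P(X)\to[0,1]$ with $\mu(X)=1$, $\mu(A\cup B)=\mu(A)+\mu(B)$ for all disjoint $A,B\subseteq X$, and $\mu(gA)=\mu(A)$ for all $g\in G$, $A\subseteq X$. *)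

theory Defs
  imports Complex_Main "HOL-Algebra.Group_Action" "HOL-Algebra.Generated_Groups"
begin

section \<open>Monoids given by generators and relations\<close>

inductive word_eq :: "('x list \<times> 'x list) set \<Rightarrow> 'x list \<Rightarrow> 'x list \<Rightarrow> bool" for R where
  step: "(u, v) \<in> R \<Longrightarrow> word_eq R (p @ u @ s) (p @ v @ s)"
| refl: "word_eq R w w"
| sym: "word_eq R u v \<Longrightarrow> word_eq R v u"
| trans: "word_eq R u v \<Longrightarrow> word_eq R v w \<Longrightarrow> word_eq R u w"

definition word_class :: "'x set \<Rightarrow> ('x list \<times> 'x list) set \<Rightarrow> 'x list \<Rightarrow> 'x list set" where
  "word_class S R u = {v \<in> lists S. word_eq R u v}"

definition presented_monoid :: "'x set \<Rightarrow> ('x list \<times> 'x list) set \<Rightarrow> 'x list set monoid" where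
  "presented_monoid S R =
     \<lparr>carrier = word_class S R ` lists S,
      mult = (\<lambda>A B. \<Union>u\<in>A. \<Union>v\<in>B. word_class S R (u @ v)),
      one = word_class S R []\<rparr>"

lemma word_eq_context:
  assumes "word_eq R u v"
  shows "word_eq R (p @ u @ s) (p @ v @ s)"
  using assms
proof (induction arbitrary: p s)
  case (step u v p' s')
  show ?case using word_eq.step[OF step.hyps, of "p @ p'" "s' @ s"] by simp
next
  case (sym u v)
  show ?case by (rule word_eq.sym[OF sym.IH])
next
  case (trans u v w)
  show ?case by (rule word_eq.trans[OF trans.IH])
qed (rule word_eq.refl)

lemma word_eq_append:
  assumes "word_eq R u u'" "word_eq R v v'"
  shows "word_eq R (u @ v) (u' @ v')"
  using word_eq.trans[of R "u @ v" "u' @ v" "u' @ v'"]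
    word_eq_context[OF assms(1), of "[]" v] word_eq_context[OF assms(2), of u' "[]"]
  by simp

lemma word_class_eq_iff:
  assumes "u \<in> lists S" "v \<in> lists S"
  shows "word_class S R u = word_class S R v \<longleftrightarrow> word_eq R u v"
proof
  assume "word_class S R u = word_class S R v"
  moreover have "v \<in> word_class S R v"
    using assms by (simp add: word_class_def word_eq.refl)
  ultimately show "word_eq R u v"
    by (auto simp: word_class_def)
next
  assume uv: "word_eq R u v"
  have "word_eq R u w \<longleftrightarrow> word_eq R v w" for w
    using word_eq.trans[OF uv] word_eq.trans[OF word_eq.sym[OF uv]] by blast
  then show "word_class S R u = word_class S R v"
    by (simp add: word_class_def)
qed

lemma presented_monoid_mult:
  assumes "u \<in> lists S" "v \<in> lists S"
  shows "word_class S R u \<otimes>\<^bsub>presented_monoid S R\<^esub> word_class S R v = word_class S R (u @ v)"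
proof -
  have eq: "word_class S R (u' @ v') = word_class S R (u @ v)"
    if "u' \<in> word_class S R u" "v' \<in> word_class S R v" for u' v'
  proof -
    have "u' \<in> lists S" "v' \<in> lists S" "word_eq R (u' @ v') (u @ v)"
      using that by (simp_all add: word_class_def word_eq_append word_eq.sym)
    then show ?thesis
      using assms by (simp add: word_class_eq_iff)
  qed
  have "u \<in> word_class S R u" "v \<in> word_class S R v"
    using assms by (simp_all add: word_class_def word_eq.refl)
  then show ?thesis
    unfolding presented_monoid_def by (simp, use eq in blast)
qed

lemma group_presented_monoid:
  assumes inv: "\<And>x. x \<in> S \<Longrightarrow> \<exists>y\<in>S. word_eq R [y, x] []"
  shows "group (presented_monoid S R)"
proof -
  let ?P = "presented_monoid S R"
  have carr: "carrier ?P = word_class S R ` lists S" and one: "\<one>\<^bsub>?P\<^esub> = word_class S R []"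
    by (simp_all add: presented_monoid_def)
  have winv: "\<exists>v\<in>lists S. word_eq R (v @ u) []" if "u \<in> lists S" for u
    using that
  proof (induction u)
    case Nil
    show ?case by (rule bexI[of _ "[]"]) (simp_all add: word_eq.refl)
  next
    case (Cons x u)
    then obtain v y where "v \<in> lists S" "word_eq R (v @ u) []" "y \<in> S" "word_eq R [y, x] []"
      using inv by blast
    then have "v @ [y] \<in> lists S" "word_eq R ((v @ [y]) @ x # u) []"
      using word_eq.trans[OF word_eq_context[of R "[y, x]" "[]" v u], of "[]"] by simp_all
    then show ?case by blast
  qed
  show ?thesis
  proof (rule groupI)
    fix a assume "a \<in> carrier ?P"
    then obtain u where u: "u \<in> lists S" "a = word_class S R u"
      using carr by auto
    obtain v where v: "v \<in> lists S" "word_eq R (v @ u) []"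
      using winv u(1) by blast
    have "word_class S R v \<otimes>\<^bsub>?P\<^esub> a = \<one>\<^bsub>?P\<^esub>"
      using u v by (simp add: presented_monoid_mult one word_class_eq_iff)
    then show "\<exists>b\<in>carrier ?P. b \<otimes>\<^bsub>?P\<^esub> a = \<one>\<^bsub>?P\<^esub>"
      using v(1) carr by blast
  next
    fix a b assume "a \<in> carrier ?P" "b \<in> carrier ?P"
    then obtain u v where uv: "u \<in> lists S" "a = word_class S R u" "v \<in> lists S" "b = word_class S R v"
      using carr by auto
    then have "u @ v \<in> lists S" "a \<otimes>\<^bsub>?P\<^esub> b = word_class S R (u @ v)"
      by (simp_all add: presented_monoid_mult)
    then show "a \<otimes>\<^bsub>?P\<^esub> b \<in> carrier ?P"
      using carr by blast
  next
    fix a b c assume "a \<in> carrier ?P" "b \<in> carrier ?P" "c \<in> carrier ?P"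
    then obtain u v w where "u \<in> lists S" "a = word_class S R u" "v \<in> lists S" "b = word_class S R v"
        "w \<in> lists S" "c = word_class S R w"
      using carr by auto
    then show "a \<otimes>\<^bsub>?P\<^esub> b \<otimes>\<^bsub>?P\<^esub> c = a \<otimes>\<^bsub>?P\<^esub> (b \<otimes>\<^bsub>?P\<^esub> c)"
      by (simp add: presented_monoid_mult)
  next
    show "\<one>\<^bsub>?P\<^esub> \<in> carrier ?P"
      using one carr by blast
  next
    fix a assume "a \<in> carrier ?P"
    then obtain u where "u \<in> lists S" "a = word_class S R u"
      using carr by auto
    then show "\<one>\<^bsub>?P\<^esub> \<otimes>\<^bsub>?P\<^esub> a = a"
      using one by (simp add: presented_monoid_mult)
  qed
qed


section \<open>Free groups and amalgamated free products\<close>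

text \<open>The letter \<open>(x, True)\<close> stands for the generator \<open>x\<close>, and \<open>(x, False)\<close> for its inverse.\<close>

definition free_rel :: "'x set \<Rightarrow> (('x \<times> bool) list \<times> ('x \<times> bool) list) set" where
  "free_rel S = {([(x, b), (x, \<not> b)], []) | x b. x \<in> S}"

definition free_group :: "'x set \<Rightarrow> ('x \<times> bool) list set monoid" where
  "free_group S = presented_monoid (S \<times> UNIV) (free_rel S)"

definition free_group_elem :: "'x set \<Rightarrow> ('x \<times> bool) list \<Rightarrow> ('x \<times> bool) list set" where
  "free_group_elem S w = word_class (S \<times> UNIV) (free_rel S) w"

lemma group_free_group: "group (free_group S)"
  unfolding free_group_def
proof (rule group_presented_monoid)
  fix z :: "'a \<times> bool" assume "z \<in> S \<times> UNIV"
  then obtain x b where z: "z = (x, b)" "x \<in> S"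
    by blast
  then have "([(x, \<not> b), (x, \<not> \<not> b)], []) \<in> free_rel S"
    unfolding free_rel_def by blast
  then have "word_eq (free_rel S) [(x, \<not> b), z] []"
    using word_eq.step[of "[(x, \<not> b), z]" "[]" "free_rel S" "[]" "[]"] z(1) by simp
  then show "\<exists>y\<in>S \<times> UNIV. word_eq (free_rel S) [y, z] []"
    using z(2) by blast
qed

text \<open>
  The amalgamated free product of \<open>A\<close> and \<open>B\<close> in which each \<open>x\<close> in the subgroup \<open>C\<close> of \<open>A\<close> is
  identified with \<open>\<phi> x\<close> in \<open>B\<close>, for an injective homomorphism \<open>\<phi>\<close> from \<open>C\<close> to \<open>B\<close>: words over the
  disjoint union of the two carriers, modulo the multiplication tables of \<open>A\<close> and \<open>B\<close> and the
  identification.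
\<close>

definition amalgam_rel ::
  "('a, 'm) monoid_scheme \<Rightarrow> ('b, 'n) monoid_scheme \<Rightarrow> 'a set \<Rightarrow> ('a \<Rightarrow> 'b)
     \<Rightarrow> (('a + 'b) list \<times> ('a + 'b) list) set" where
  "amalgam_rel A B C \<phi> =
     {([Inl x, Inl y], [Inl (x \<otimes>\<^bsub>A\<^esub> y)]) | x y. x \<in> carrier A \<and> y \<in> carrier A}
   \<union> {([Inr x, Inr y], [Inr (x \<otimes>\<^bsub>B\<^esub> y)]) | x y. x \<in> carrier B \<and> y \<in> carrier B}
   \<union> {([Inl \<one>\<^bsub>A\<^esub>], []), ([Inr \<one>\<^bsub>B\<^esub>], [])}
   \<union> {([Inl x], [Inr (\<phi> x)]) | x. x \<in> C}"

definition amalgamated_product ::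
  "('a, 'm) monoid_scheme \<Rightarrow> ('b, 'n) monoid_scheme \<Rightarrow> 'a set \<Rightarrow> ('a \<Rightarrow> 'b)
     \<Rightarrow> ('a + 'b) list set monoid" where
  "amalgamated_product A B C \<phi> =
     presented_monoid (carrier A <+> carrier B) (amalgam_rel A B C \<phi>)"

lemma group_amalgamated_product:
  assumes "group A" "group B"
  shows "group (amalgamated_product A B C \<phi>)"
  unfolding amalgamated_product_def
proof (rule group_presented_monoid)
  interpret A: group A by fact
  interpret B: group B by fact
  let ?R = "amalgam_rel A B C \<phi>"
  have rel: "word_eq ?R u v" if "(u, v) \<in> ?R" for u v
    using word_eq.step[OF that, of "[]" "[]"] by simp
  fix z assume "z \<in> carrier A <+> carrier B"
  then consider x where "x \<in> carrier A" "z = Inl x" | x where "x \<in> carrier B" "z = Inr x"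
    by blast
  then show "\<exists>y\<in>carrier A <+> carrier B. word_eq ?R [y, z] []"
  proof cases
    case (1 x)
    have "word_eq ?R [Inl (inv\<^bsub>A\<^esub> x), Inl x] [Inl (inv\<^bsub>A\<^esub> x \<otimes>\<^bsub>A\<^esub> x)]" "word_eq ?R [Inl \<one>\<^bsub>A\<^esub>] []"
      using 1 A.inv_closed by (intro rel; unfold amalgam_rel_def; blast)+
    then have "word_eq ?R [Inl (inv\<^bsub>A\<^esub> x), z] []"
      using 1 by (metis A.l_inv word_eq.trans)
    moreover have "Inl (inv\<^bsub>A\<^esub> x) \<in> carrier A <+> carrier B"
      using 1 by blast
    ultimately show ?thesis by blast
  next
    case (2 x)
    have "word_eq ?R [Inr (inv\<^bsub>B\<^esub> x), Inr x] [Inr (inv\<^bsub>B\<^esub> x \<otimes>\<^bsub>B\<^esub> x)]" "word_eq ?R [Inr \<one>\<^bsub>B\<^esub>] []"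
      using 2 B.inv_closed by (intro rel; unfold amalgam_rel_def; blast)+
    then have "word_eq ?R [Inr (inv\<^bsub>B\<^esub> x), z] []"
      using 2 by (metis B.l_inv word_eq.trans)
    moreover have "Inr (inv\<^bsub>B\<^esub> x) \<in> carrier A <+> carrier B"
      using 2 by blast
    ultimately show ?thesis by blast
  qed
qed

datatype gen = Alpha | Beta

abbreviation F2 :: "(gen \<times> bool) list set monoid" where
  "F2 \<equiv> free_group UNIV"

text \<open>
  Both factors are the concrete group \<open>F2\<close>; the disjoint union in the amalgamated product makes them
  different copies, with generators \<open>\<alpha>, \<beta>\<close> in the left one and \<open>\<alpha>', \<beta>'\<close> in the right one. The word
  \<open>c(\<alpha>', \<beta>')\<close> is the copy of \<open>c(\<alpha>, \<beta>)\<close>, so the identification of the two cyclic subgroups is the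
  identity map. The word \<open>c\<close> need not be reduced and may represent the identity.
\<close>

definition F2_amalgam ::
  "(gen \<times> bool) list \<Rightarrow> ((gen \<times> bool) list set + (gen \<times> bool) list set) list set monoid" where
  "F2_amalgam c =
     amalgamated_product F2 F2 (generate F2 {free_group_elem UNIV c}) (\<lambda>x. x)"

lemma group_F2_amalgam: "group (F2_amalgam c)"
  unfolding F2_amalgam_def by (intro group_amalgamated_product group_free_group)


section \<open>Amenable actions\<close>

text \<open>
  An invariant mean forces the underlying set to be nonempty. The groups considered here are
  countable, so a set on which one of them acts transitively is countable; existence of such an
  action can therefore be stated for subsets of \<open>nat\<close> without loss of generality.
\<close>

definition invariant_mean ::
  "('g, 'm) monoid_scheme \<Rightarrow> 'x set \<Rightarrow> ('g \<Rightarrow> 'x \<Rightarrow> 'x) \<Rightarrow> ('x set \<Rightarrow> real) \<Rightarrow> bool" where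
  "invariant_mean G X \<phi> \<mu> \<longleftrightarrow>
     (\<forall>A. A \<subseteq> X \<longrightarrow> 0 \<le> \<mu> A \<and> \<mu> A \<le> 1) \<and>
     \<mu> X = 1 \<and>
     (\<forall>A B. A \<subseteq> X \<longrightarrow> B \<subseteq> X \<longrightarrow> A \<inter> B = {} \<longrightarrow> \<mu> (A \<union> B) = \<mu> A + \<mu> B) \<and>
     (\<forall>g\<in>carrier G. \<forall>A. A \<subseteq> X \<longrightarrow> \<mu> (\<phi> g ` A) = \<mu> A)"

locale amenable_action = group_action +
  assumes amenable: "\<exists>\<mu>. invariant_mean G E \<phi> \<mu>"

end

theory Submission
  imports Defs "HOL-Analysis.Function_Topology"
begin

text \<open>
  Write \<open>F\<close> and \<open>F'\<close> for the two factors of the amalgamated product \<open>G\<close>. A faithful amenable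
  action has to reconcile two demands: somewhere in the space \<open>G\<close> must act like an amenable group, and
  yet no element other than the identity may act trivially. Both are met in one space cut in two:
  the upper part sees only a homomorphism to the integers, the lower part sees all of \<open>G\<close>.

  There is a nonzero homomorphism from \<open>F\<close> to the integers that kills \<open>c\<close>
  (\<open>exists_weights_killing\<close>). Let \<open>G\<close> act on \<open>G \<times> bool \<times> int\<close>, where the last coordinate is a level,
  as follows. A generator of \<open>F\<close> raises the level by its value under the homomorphism. If it starts
  below level \<open>0\<close>, it also multiplies the first coordinate from the left, by its copy in \<open>F\<close> or in
  \<open>F'\<close> depending on the Boolean. From level \<open>0\<close> on it changes nothing but the level. Each generator acts as
  a bijection, which is all that an action of the free group \<open>F\<close> requires.

  To let \<open>F'\<close> act compatibly, conjugate the action of \<open>F\<close> by the involution that flips the Boolean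
  on all levels up to a bound \<open>T\<close>. The relation of \<open>G\<close> holds if this involution commutes with \<open>c\<close>.
  It does: \<open>c\<close> preserves each level, above \<open>T\<close> the involution is the identity, and if \<open>T\<close> is very low,
  \<open>c\<close> acts up to \<open>T\<close> as multiplication by the element that the two copies of \<open>c\<close> have in
  common (\<open>flip_commutes\<close>).

  Consequently every \<open>g\<close> in \<open>G\<close> acts on sufficiently high levels as a translation of the levels, and on
  sufficiently low levels, at points with Boolean \<open>False\<close>, as left multiplication by \<open>g\<close> combined with
  a translation (\<open>translates_act\<close>).

  A subgroup \<open>H\<close> of finite index contains a power of a generator of positive weight. Hence the \<open>H\<close>-orbit
  of \<open>(\<one>, False, 0)\<close> reaches arbitrarily low levels, where it shows that \<open>H\<close> acts faithfully on it,
  and it contains the points \<open>(\<one>, False, j)\<close> for an arithmetic progression of levels \<open>j \<ge> 0\<close>. As these points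
  are eventually only translated, a mean on the integers that vanishes on sets bounded above yields
  an invariant mean on the orbit (\<open>finite_index_subgroup_action\<close>).
\<close>

section \<open>A translation-invariant mean on the integers\<close>

lemma compact_unit_functions: "compact {m :: 'a \<Rightarrow> real. \<forall>x. 0 \<le> m x \<and> m x \<le> 1}"
proof -
  have "compactin (product_topology (\<lambda>_. euclidean) UNIV) (PiE UNIV (\<lambda>_::'a. {0..1::real}))"
    by (simp add: compactin_PiE)
  then show ?thesis
    by (simp add: euclidean_product_topology PiE_UNIV_domain Pi_def)
qed

text \<open>
  By Tychonoff's theorem the sequence has a cluster point \<open>m\<close> in the compact space of functions
  into the unit interval. Intersecting \<open>sequentially\<close> with the preimage of the neighbourhoods of
  \<open>m\<close> replaces a convergent subnet, so that limits of real sequences can be taken along one fixed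
  filter \<open>F\<close>.
\<close>

lemma exists_pointwise_limit:
  fixes d :: "nat \<Rightarrow> 'a \<Rightarrow> real"
  assumes "\<And>n x. 0 \<le> d n x \<and> d n x \<le> 1"
  obtains m F where "F \<noteq> bot" "F \<le> sequentially" "\<And>x. ((\<lambda>n. d n x) \<longlongrightarrow> m x) F"
proof -
  let ?K = "{m :: 'a \<Rightarrow> real. \<forall>x. 0 \<le> m x \<and> m x \<le> 1}"
  have "filtermap d sequentially \<noteq> bot" "eventually (\<lambda>m. m \<in> ?K) (filtermap d sequentially)"
    using assms by (auto simp: filtermap_bot_iff eventually_filtermap)
  then have "\<exists>m\<in>?K. inf (nhds m) (filtermap d sequentially) \<noteq> bot"
    by (intro compact_filter[THEN iffD1, rule_format, OF compact_unit_functions])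
  then obtain m where m: "inf (nhds m) (filtermap d sequentially) \<noteq> bot"
    by blast
  define F where "F = inf (filtercomap d (nhds m)) sequentially"
  have "F \<noteq> bot"
  proof
    assume "F = bot"
    then have "eventually (\<lambda>_. False) F" by simp
    then obtain P Q where P: "eventually P (nhds m)" and Q: "eventually Q sequentially"
      and PQ: "\<And>n. Q n \<Longrightarrow> P (d n) \<Longrightarrow> False"
      unfolding F_def eventually_inf eventually_filtercomap by blast
    have "eventually (\<lambda>f. \<not> P f) (filtermap d sequentially)"
      unfolding eventually_filtermap using Q by (rule eventually_mono) (use PQ in blast)
    then have "eventually (\<lambda>_. False) (inf (nhds m) (filtermap d sequentially))"
      using P unfolding eventually_inf by blast
    then show False using m by (simp add: trivial_limit_def)
  qed
  moreover have "((\<lambda>n. d n x) \<longlongrightarrow> m x) F" for x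
  proof -
    have d_lim: "filterlim d (nhds m) F"
      unfolding F_def by (rule filterlim_mono[OF filterlim_filtercomap order_refl inf_le1])
    show ?thesis
    proof (rule topological_tendstoI)
      fix S :: "real set" assume "open S" "m x \<in> S"
      then have "open ((\<lambda>f :: 'a \<Rightarrow> real. f x) -` S)"
        using continuous_on_product_coordinates[of x] by (intro open_vimage)
      then have "eventually (\<lambda>f. f \<in> (\<lambda>f. f x) -` S) (nhds m)"
        using \<open>m x \<in> S\<close> by (intro eventually_nhds_in_open) simp_all
      then show "eventually (\<lambda>n. d n x \<in> S) F"
        using d_lim unfolding filterlim_iff by auto
    qed
  qed
  ultimately show ?thesis
    using that[of F m] by (simp add: F_def)
qed

text \<open>
  A limit of the densities in \<open>{0..n}\<close>: translating a set by one, or changing it below a bound,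
  changes these densities by \<open>O(1/n)\<close> only.
\<close>

lemma exists_mean_at_infinity:
  obtains m :: "int set \<Rightarrow> real" where
    "\<forall>A. 0 \<le> m A" "m UNIV = 1" "\<forall>A B. A \<inter> B = {} \<longrightarrow> m (A \<union> B) = m A + m B"
    "\<forall>A k. m {j. j - k \<in> A} = m A"
    "\<forall>A B J. (\<forall>j\<ge>J. j \<in> A \<longleftrightarrow> j \<in> B) \<longrightarrow> m A = m B"
proof -
  let ?f = "\<lambda>A. indicator A :: int \<Rightarrow> real"
  define d :: "nat \<Rightarrow> int set \<Rightarrow> real"
    where "d n A = (\<Sum>k<Suc n. ?f A (int k)) / real (Suc n)" for n A
  have "0 \<le> d n A \<and> d n A \<le> 1" for n A
    using sum_bounded_above[of "{..<Suc n}" "\<lambda>k. ?f A (int k)" 1]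
    unfolding d_def by (auto simp: divide_le_eq_1 indicator_def intro!: divide_nonneg_nonneg sum_nonneg)
  then obtain m F where F: "F \<noteq> bot" "F \<le> sequentially" and lim: "\<And>A. ((\<lambda>n. d n A) \<longlongrightarrow> m A) F"
    and d01: "\<And>n A. 0 \<le> d n A \<and> d n A \<le> 1"
    using exists_pointwise_limit by metis
  have null: "m A = m B" if "\<And>n. \<bar>d n A - d n B\<bar> \<le> C / real (Suc n)" for A B C
  proof -
    have "(\<lambda>n. C / real (Suc n)) \<longlonglongrightarrow> 0"
      by (rule LIMSEQ_Suc) (rule lim_const_over_n)
    then have "((\<lambda>n. C / real (Suc n)) \<longlongrightarrow> 0) F"
      using F(2) by (rule tendsto_mono[rotated])
    moreover have "((\<lambda>n. \<bar>d n A - d n B\<bar>) \<longlongrightarrow> \<bar>m A - m B\<bar>) F"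
      by (intro tendsto_intros lim)
    ultimately have "\<bar>m A - m B\<bar> \<le> 0"
      using F(1) that by (intro tendsto_le[OF F(1)]) (auto intro: always_eventually)
    then show ?thesis by simp
  qed
  have shift: "m {j. j - 1 \<in> A} = m A" for A
  proof (rule null[where C = 1])
    fix n
    have "(\<Sum>k<Suc n. ?f {j. j - 1 \<in> A} (int k)) = ?f A (-1) + (\<Sum>k<n. ?f A (int k))"
      by (subst sum.lessThan_Suc_shift) (simp add: indicator_def)
    then have "d n {j. j - 1 \<in> A} - d n A = (?f A (-1) - ?f A (int n)) / real (Suc n)"
      unfolding d_def diff_divide_distrib[symmetric] by simp
    moreover have "\<bar>?f A (-1) - ?f A (int n)\<bar> \<le> 1"
      by (simp add: indicator_def)
    ultimately show "\<bar>d n {j. j - 1 \<in> A} - d n A\<bar> \<le> 1 / real (Suc n)"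
      by (simp add: divide_right_mono)
  qed
  show ?thesis
  proof (rule that; (intro allI impI)?)
    show "0 \<le> m A" for A
      using lim d01 F(1) by (intro tendsto_lowerbound[OF lim]) auto
    have "d n UNIV = 1" for n by (simp add: d_def)
    then show "m UNIV = 1"
      using tendsto_unique[OF F(1) lim[of UNIV]] by simp
    show "m (A \<union> B) = m A + m B" if "A \<inter> B = {}" for A B
    proof -
      have "indicator (A \<union> B) j = ?f A j + ?f B j" for j
        using that by (auto simp: indicator_def)
      then have "d n (A \<union> B) = d n A + d n B" for n
        by (simp add: d_def sum.distrib add_divide_distrib del: sum.lessThan_Suc)
      then show ?thesis
        using tendsto_unique[OF F(1) lim[of "A \<union> B"]] tendsto_add[OF lim[of A] lim[of B]] by simp
    qed
    show "m {j. j - k \<in> A} = m A" for A k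
    proof (induction k rule: int_induct[where k = 0])
      case (step1 i)
      have "{j. j - (i + 1) \<in> A} = {j. j - 1 \<in> {j. j - i \<in> A}}"
        by (simp add: algebra_simps)
      then show ?case using shift[of "{j. j - i \<in> A}"] step1 by simp
    next
      case (step2 i)
      have "{j. j - i \<in> A} = {j. j - 1 \<in> {j. j - (i - 1) \<in> A}}"
        by (simp add: algebra_simps)
      then show ?case using shift[of "{j. j - (i - 1) \<in> A}"] step2 by simp
    qed simp
    show "m A = m B" if AB: "\<forall>j\<ge>J. j \<in> A \<longleftrightarrow> j \<in> B" for A B J
    proof (rule null[where C = "real (nat J)"])
      fix n
      have "\<bar>(\<Sum>k<Suc n. ?f A (int k) - ?f B (int k))\<bar> \<le> (\<Sum>k<Suc n. \<bar>?f A (int k) - ?f B (int k)\<bar>)"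
        by (rule sum_abs)
      also have "\<dots> \<le> (\<Sum>k<Suc n. if k < nat J then 1 else 0)"
        using AB by (intro sum_mono) (auto simp: indicator_def nat_less_iff not_less)
      also have "\<dots> = real (card ({..<Suc n} \<inter> {..<nat J}))"
        by (simp add: sum.If_cases lessThan_def del: sum.lessThan_Suc)
      also have "\<dots> \<le> real (nat J)"
        using card_mono[of "{..<nat J}" "{..<Suc n} \<inter> {..<nat J}"] by simp
      finally show "\<bar>d n A - d n B\<bar> \<le> real (nat J) / real (Suc n)"
        unfolding d_def diff_divide_distrib[symmetric] sum_subtractf[symmetric] abs_divide
        by (simp add: divide_right_mono del: sum.lessThan_Suc)
    qed
  qed
qed


section \<open>Amenable actions from points that are eventually translated\<close>

text \<open>
  The sequence \<open>q\<close> runs off to a part of the space where every group element only translates it, so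
  a mean on the integers that does not see sets bounded above pulls back along \<open>q\<close> to an invariant
  mean. Only some of the points \<open>q j\<close> need lie in the set \<open>X\<close> on which the mean is
  wanted; the mean can be normalised on \<open>X\<close> because these indices contain an arithmetic
  progression, finitely many translates of which cover all nonnegative integers.
\<close>

lemma mean_of_asymptotic_translations:
  fixes act :: "'g \<Rightarrow> 'x \<Rightarrow> 'x" and q :: "int \<Rightarrow> 'x" and p :: int
  assumes inj: "\<And>g. g \<in> carrier G \<Longrightarrow> inj_on (act g) \<Omega>"
    and \<Omega>: "X \<subseteq> \<Omega>" "range q \<subseteq> \<Omega>"
    and translation: "\<And>g. g \<in> carrier G \<Longrightarrow> \<exists>d J. \<forall>j\<ge>J. act g (q j) = q (j + d)"
    and p: "p > 0" "\<And>n::nat. q (int n * p) \<in> X"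
  shows "\<exists>\<mu>. invariant_mean G X act \<mu>"
proof -
  obtain m :: "int set \<Rightarrow> real" where m_all: "\<forall>A. 0 \<le> m A" "m UNIV = 1"
      "\<forall>A B. A \<inter> B = {} \<longrightarrow> m (A \<union> B) = m A + m B" "\<forall>A k. m {j. j - k \<in> A} = m A"
      "\<forall>A B J. (\<forall>j\<ge>J. j \<in> A \<longleftrightarrow> j \<in> B) \<longrightarrow> m A = m B"
    using exists_mean_at_infinity .
  note m = m_all(1-4)[rule_format]
  have tail: "m A = m B" if "\<And>j. j \<ge> J \<Longrightarrow> j \<in> A \<longleftrightarrow> j \<in> B" for A B J
    using m_all(5) that by blast
  have mono: "m A \<le> m B" if "A \<subseteq> B" for A B
    using m(3)[of A "B - A"] m(1)[of "B - A"] that by (simp add: Un_absorb1)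
  have subadd: "m (A \<union> B) \<le> m A + m B" for A B
    using m(3)[of A "B - A"] mono[of "B - A" B] by simp
  let ?D = "{j. q j \<in> X}"
  have pos: "m ?D > 0"
  proof (rule ccontr)
    assume "\<not> m ?D > 0"
    then have zero: "m ?D = 0" using m(1)[of ?D] by simp
    \<comment> \<open>Then all finite unions of translates of \<open>?D\<close> are null, but \<open>p\<close> of them cover a half-line.\<close>
    have "m (\<Union>r<n. {j. j - int r \<in> ?D}) \<le> 0" for n :: nat
    proof (induction n)
      case 0
      have "m {} = 0" using m(3)[of "{}" "{}"] by simp
      then show ?case by simp
    next
      case (Suc n)
      have "m {j. j - int n \<in> ?D} = 0" using m(4)[of "int n" ?D] zero by simp
      then show ?case
        using subadd[of "{j. j - int n \<in> ?D}" "\<Union>r<n. {j. j - int r \<in> ?D}"] Suc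
        by (simp add: lessThan_Suc)
    qed
    moreover have "m UNIV = m (\<Union>r<nat p. {j. j - int r \<in> ?D})"
    proof (rule tail[of 0])
      fix j :: int assume "j \<ge> 0"
      then have "j - int (nat (j mod p)) = int (nat (j div p)) * p"
        using p(1) by (simp add: minus_mod_eq_div_mult pos_imp_zdiv_nonneg_iff)
      then have "q (j - int (nat (j mod p))) \<in> X" using p(2) by metis
      moreover have "nat (j mod p) < nat p" using p(1) by simp
      ultimately show "j \<in> UNIV \<longleftrightarrow> j \<in> (\<Union>r<nat p. {j. j - int r \<in> ?D})" by blast
    qed
    ultimately show False using m(2) by (metis not_one_le_zero)
  qed
  define \<mu> where "\<mu> A = m {j. q j \<in> A} / m ?D" for A
  have "invariant_mean G X act \<mu>"
    unfolding invariant_mean_def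
  proof (intro conjI allI impI ballI)
    fix A assume "A \<subseteq> X"
    then have "m {j. q j \<in> A} \<le> m ?D" by (intro mono) auto
    then show "0 \<le> \<mu> A" "\<mu> A \<le> 1"
      using pos m(1) by (simp_all add: \<mu>_def)
  next
    show "\<mu> X = 1" using pos by (simp add: \<mu>_def)
  next
    fix A B :: "'x set" assume "A \<inter> B = {}"
    then have "{j. q j \<in> A} \<inter> {j. q j \<in> B} = {}" by blast
    moreover have "{j. q j \<in> A \<union> B} = {j. q j \<in> A} \<union> {j. q j \<in> B}" by blast
    ultimately show "\<mu> (A \<union> B) = \<mu> A + \<mu> B"
      unfolding \<mu>_def by (simp only: m(3) add_divide_distrib)
  next
    fix g A assume g: "g \<in> carrier G" and A: "A \<subseteq> X"
    obtain d J where dJ: "\<And>j. j \<ge> J \<Longrightarrow> act g (q j) = q (j + d)" using translation[OF g] by blast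
    have "m {j. q j \<in> act g ` A} = m {j. j - d \<in> {j. q j \<in> A}}"
    proof (rule tail[of "J + d"])
      fix j assume "j \<ge> J + d"
      then have "act g (q (j - d)) = q j" using dJ[of "j - d"] by simp
      moreover have "q (j - d) \<in> \<Omega>" "A \<subseteq> \<Omega>" using A \<Omega> by auto
      ultimately have "q j \<in> act g ` A \<longleftrightarrow> q (j - d) \<in> A"
        using inj_on_image_mem_iff[OF inj[OF g], of "q (j - d)" A] by simp
      then show "j \<in> {j. q j \<in> act g ` A} \<longleftrightarrow> j \<in> {j. j - d \<in> {j. q j \<in> A}}" by simp
    qed
    then show "\<mu> (act g ` A) = \<mu> A" by (simp add: \<mu>_def m(4)[of d "{j. q j \<in> A}", simplified])
  qed
  then show ?thesis by blast
qed

text \<open>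
  Transport along an enumeration of \<open>E\<close>. The functions \<open>act g\<close> may do anything outside \<open>E\<close>,
  whereas a \<^locale>\<open>group_action\<close> takes values in extensional bijections.
\<close>

lemma countable_action_on_nat:
  fixes act :: "'g \<Rightarrow> 'x \<Rightarrow> 'x"
  assumes "group G" and count: "countable E"
    and closed: "\<And>g x. g \<in> carrier G \<Longrightarrow> x \<in> E \<Longrightarrow> act g x \<in> E"
    and one: "\<And>x. x \<in> E \<Longrightarrow> act \<one>\<^bsub>G\<^esub> x = x"
    and mult: "\<And>g h x. g \<in> carrier G \<Longrightarrow> h \<in> carrier G \<Longrightarrow> x \<in> E \<Longrightarrow> act (g \<otimes>\<^bsub>G\<^esub> h) x = act g (act h x)"
    and trans: "\<And>x y. x \<in> E \<Longrightarrow> y \<in> E \<Longrightarrow> \<exists>g\<in>carrier G. act g x = y"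
    and faithful: "\<And>g. g \<in> carrier G \<Longrightarrow> (\<And>x. x \<in> E \<Longrightarrow> act g x = x) \<Longrightarrow> g = \<one>\<^bsub>G\<^esub>"
    and mean: "\<exists>\<mu>. invariant_mean G E act \<mu>"
  shows "\<exists>(X :: nat set) \<phi>. transitive_action G X \<phi> \<and> faithful_action G X \<phi> \<and> amenable_action G X \<phi>"
proof -
  interpret group G by fact
  define e where "e = to_nat_on E"
  define e' where "e' = inv_into E e"
  define X where "X = e ` E"
  define \<phi> where "\<phi> g = restrict (\<lambda>n. e (act g (e' n))) X" for g
  have inj: "inj_on e E" unfolding e_def using count by (rule inj_on_to_nat_on)
  have e'e: "e' (e x) = x" if "x \<in> E" for x
    unfolding e'_def using inj that by (rule inv_into_f_f)
  have \<phi>e: "\<phi> g (e x) = e (act g x)" if "x \<in> E" for g x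
    using that by (simp add: \<phi>_def X_def e'e)
  have \<phi>_closed: "\<phi> g n \<in> X" if "g \<in> carrier G" "n \<in> X" for g n
    using that \<phi>e closed by (auto simp: X_def)
  have \<phi>_mult: "\<phi> (g \<otimes>\<^bsub>G\<^esub> h) n = \<phi> g (\<phi> h n)" if "g \<in> carrier G" "h \<in> carrier G" "n \<in> X" for g h n
    using that \<phi>e closed mult by (auto simp: X_def)
  have \<phi>_one: "\<phi> \<one>\<^bsub>G\<^esub> n = n" if "n \<in> X" for n
    using that \<phi>e one by (auto simp: X_def)
  have Bij: "\<phi> g \<in> Bij X" if g: "g \<in> carrier G" for g
  proof -
    have "bij_betw (\<phi> g) X X"
      using g \<phi>_closed \<phi>_mult[symmetric] \<phi>_one
      by (intro bij_betw_byWitness[where f' = "\<phi> (inv\<^bsub>G\<^esub> g)"]) auto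
    then show ?thesis by (simp add: Bij_def \<phi>_def)
  qed
  have "group_hom G (BijGroup X) \<phi>"
  proof (intro group_hom.intro group_hom_axioms.intro homI is_group group_BijGroup)
    show "\<phi> g \<in> carrier (BijGroup X)" if "g \<in> carrier G" for g
      using Bij[OF that] by (simp add: BijGroup_def)
    fix g h assume gh: "g \<in> carrier G" "h \<in> carrier G"
    have "\<phi> (g \<otimes>\<^bsub>G\<^esub> h) n = compose X (\<phi> g) (\<phi> h) n" for n
      using gh \<phi>_mult by (cases "n \<in> X") (auto simp: compose_def \<phi>_def)
    then show "\<phi> (g \<otimes>\<^bsub>G\<^esub> h) = \<phi> g \<otimes>\<^bsub>BijGroup X\<^esub> \<phi> h"
      using gh Bij by (auto simp: BijGroup_def)
  qed
  then have action: "group_action G X \<phi>" by (rule group_action.intro)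
  have "transitive_action G X \<phi>"
  proof (intro transitive_action.intro action transitive_action_axioms.intro)
    fix n k assume "n \<in> X" "k \<in> X"
    then obtain x y where xy: "x \<in> E" "n = e x" "y \<in> E" "k = e y" by (auto simp: X_def)
    then obtain g where "g \<in> carrier G" "act g x = y" using trans by blast
    then show "\<exists>g\<in>carrier G. \<phi> g n = k" using xy \<phi>e by blast
  qed
  moreover have "faithful_action G X \<phi>"
  proof (intro faithful_action.intro action faithful_action_axioms.intro inj_onI)
    fix g h assume gh: "g \<in> carrier G" "h \<in> carrier G" and eq: "\<phi> g = \<phi> h"
    have "act (inv\<^bsub>G\<^esub> h \<otimes>\<^bsub>G\<^esub> g) x = x" if x: "x \<in> E" for x
    proof -
      have "e (act g x) = e (act h x)" using eq \<phi>e[OF x] by metis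
      then have "act g x = act h x" using inj x gh closed by (auto dest: inj_onD)
      then have "act (inv\<^bsub>G\<^esub> h \<otimes>\<^bsub>G\<^esub> g) x = act (inv\<^bsub>G\<^esub> h \<otimes>\<^bsub>G\<^esub> h) x"
        using gh x by (simp only: mult inv_closed)
      then show ?thesis using gh x one by simp
    qed
    then have "inv\<^bsub>G\<^esub> h \<otimes>\<^bsub>G\<^esub> g = \<one>\<^bsub>G\<^esub>" using gh by (intro faithful) auto
    then show "g = h" using gh inv_solve_left' by fastforce
  qed
  moreover have "amenable_action G X \<phi>"
  proof (intro amenable_action.intro action amenable_action_axioms.intro)
    obtain \<mu> where \<mu>: "invariant_mean G E act \<mu>" using mean by blast
    then have add: "\<mu> (A \<union> B) = \<mu> A + \<mu> B" if "A \<subseteq> E" "B \<subseteq> E" "A \<inter> B = {}" for A B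
      using that by (simp add: invariant_mean_def)
    have sub: "e' ` A \<subseteq> E" if "A \<subseteq> X" for A using that e'e by (auto simp: X_def)
    have e'X: "e' ` X = E" using e'e by (force simp: X_def)
    have inj': "inj_on e' X" unfolding e'_def X_def by (rule inj_on_inv_into) simp
    have img: "e' ` \<phi> g ` A = act g ` e' ` A" if "A \<subseteq> X" "g \<in> carrier G" for A g
    proof -
      have "e' (\<phi> g n) = act g (e' n)" if "n \<in> A" for n
        using that \<open>A \<subseteq> X\<close> \<open>g \<in> carrier G\<close> \<phi>e e'e closed by (auto simp: X_def subset_iff)
      then show ?thesis by (simp add: image_image)
    qed
    have "invariant_mean G X \<phi> (\<lambda>A. \<mu> (e' ` A))"
      unfolding invariant_mean_def
    proof (intro conjI allI impI ballI)
      fix A B assume AB: "A \<subseteq> X" "B \<subseteq> X" "A \<inter> B = {}"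
      then have "e' ` A \<inter> e' ` B = {}"
        using inj_on_image_Int[OF inj' AB(1,2)] by simp
      then show "\<mu> (e' ` (A \<union> B)) = \<mu> (e' ` A) + \<mu> (e' ` B)"
        using add sub AB by (simp add: image_Un)
    qed (use \<mu> sub e'X img in \<open>simp_all add: invariant_mean_def\<close>)
    then show "\<exists>\<mu>. invariant_mean G X \<phi> \<mu>" by blast
  qed
  ultimately show ?thesis by blast
qed

section \<open>Passing to a subgroup of finite index\<close>

lemma (in group) finite_index_power_mem:
  assumes H: "subgroup H G" and fin: "finite (rcosets H)" and a: "a \<in> carrier G"
  obtains p :: nat where "p > 0" "a [^] p \<in> H"
proof -
  have "\<not> inj (\<lambda>n::nat. H #> a [^] n)"
  proof
    assume inj: "inj (\<lambda>n::nat. H #> a [^] n)"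
    have "range (\<lambda>n::nat. H #> a [^] n) \<subseteq> rcosets H"
      using a unfolding RCOSETS_def by auto
    then show False using inj fin finite_subset finite_imageD infinite_UNIV_nat by metis
  qed
  then obtain k n :: nat where kn: "k < n" and eq: "H #> a [^] k = H #> a [^] n"
    unfolding inj_def by (metis linorder_neqE_nat)
  have "a [^] n \<in> H #> a [^] k"
    using eq rcos_self[OF _ H] a by simp
  then obtain h where h: "h \<in> H" "a [^] n = h \<otimes> a [^] k" by (auto simp: r_coset_def)
  have "a [^] n = a [^] (n - k) \<otimes> a [^] k" using kn a by (simp add: nat_pow_mult)
  then have "a [^] (n - k) = h"
    using h a subgroup.mem_carrier[OF H] by simp
  then show ?thesis using that[of "n - k"] kn h(1) by simp
qed

text \<open>
  Think of \<open>pt x j\<close> as a copy of the group element \<open>x\<close> on level \<open>j\<close>. High up every \<open>g\<close> merely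
  changes the level; far down it also multiplies \<open>x\<close> by \<open>g\<close>. The element \<open>a\<close> moves strictly upwards
  and some power \<open>a\<^sup>p\<close> lies in \<open>H\<close>. The \<open>H\<close>-orbit of \<open>pt \<one> 0\<close> therefore contains the points
  \<open>pt \<one> (n p w)\<close> for \<open>n \<ge> 0\<close>, which gives an invariant mean, and it contains points on arbitrarily
  low levels, where \<open>h\<close> acts through multiplication by \<open>h\<close> and hence trivially only if \<open>h = \<one>\<close>.
\<close>

lemma finite_index_subgroup_action:
  fixes G (structure) and act :: "'g \<Rightarrow> 'x \<Rightarrow> 'x" and pt :: "'g \<Rightarrow> int \<Rightarrow> 'x"
  assumes "group G" and count: "countable (carrier G)"
    and closed: "\<And>g x. g \<in> carrier G \<Longrightarrow> x \<in> \<Omega> \<Longrightarrow> act g x \<in> \<Omega>"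
    and one: "\<And>x. x \<in> \<Omega> \<Longrightarrow> act \<one> x = x"
    and mult: "\<And>g h x. g \<in> carrier G \<Longrightarrow> h \<in> carrier G \<Longrightarrow> x \<in> \<Omega> \<Longrightarrow> act (g \<otimes> h) x = act g (act h x)"
    and pt: "\<And>x j. x \<in> carrier G \<Longrightarrow> pt x j \<in> \<Omega>"
    and pt_inj: "\<And>x y i j. pt x i = pt y j \<Longrightarrow> x = y"
    and high: "\<And>g. g \<in> carrier G \<Longrightarrow> \<exists>d J. \<forall>j\<ge>J. \<forall>x\<in>carrier G. act g (pt x j) = pt x (j + d)"
    and low: "\<And>g. g \<in> carrier G \<Longrightarrow> \<exists>d J. \<forall>j\<le>J. \<forall>x\<in>carrier G. act g (pt x j) = pt (g \<otimes> x) (j + d)"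
    and a: "a \<in> carrier G" and w: "w > 0"
    and act_a: "\<And>x j. x \<in> carrier G \<Longrightarrow> act a (pt x j) = pt (if j < 0 then a \<otimes> x else x) (j + w)"
    and H: "subgroup H G" and fin: "finite (rcosets H)"
  shows "\<exists>(X :: nat set) \<phi>. transitive_action (G\<lparr>carrier := H\<rparr>) X \<phi> \<and>
           faithful_action (G\<lparr>carrier := H\<rparr>) X \<phi> \<and> amenable_action (G\<lparr>carrier := H\<rparr>) X \<phi>"
proof -
  interpret group G by fact
  note H_carrier = subgroup.mem_carrier[OF H]
  define E where "E = (\<lambda>h. act h (pt \<one> 0)) ` H"
  have E\<Omega>: "E \<subseteq> \<Omega>" using closed pt H_carrier by (auto simp: E_def)
  have actE: "act h x \<in> E" if h: "h \<in> H" and x: "x \<in> E" for h x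
  proof -
    obtain k where k: "k \<in> H" "x = act k (pt \<one> 0)" using x by (auto simp: E_def)
    then have "act h x = act (h \<otimes> k) (pt \<one> 0)" using h H_carrier mult pt by simp
    then show ?thesis using h k(1) subgroup.m_closed[OF H] by (auto simp: E_def)
  qed
  have cancel: "act (inv g) (act g x) = x" if "g \<in> carrier G" "x \<in> \<Omega>" for g x
    using that mult[of "inv g" g x] one by simp
  obtain p :: nat where p: "p > 0" "a [^] p \<in> H" using finite_index_power_mem[OF H fin a] .
  have powH: "(a [^] p) [^] n \<in> H" for n :: nat
    using p(2) by (induction n) (simp_all add: subgroup.one_closed[OF H] subgroup.m_closed[OF H])
  then have pow: "a [^] (p * n) \<in> H" for n :: nat
    using a by (simp add: nat_pow_pow)
  have up: "act (a [^] n) (pt \<one> 0) = pt \<one> (int n * w)" for n :: nat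
  proof (induction n)
    case (Suc n)
    have "act (a [^] Suc n) (pt \<one> 0) = act (a \<otimes> a [^] n) (pt \<one> 0)"
      using a by (metis nat_pow_Suc2)
    then show ?case
      using Suc a w mult pt by (simp add: act_a mult_less_0_iff algebra_simps)
  qed (simp add: one pt)
  have down: "\<exists>x\<in>carrier G. act (inv (a [^] n)) (pt \<one> 0) = pt x (- int n * w)" for n :: nat
  proof (induction n)
    case 0
    show ?case using one pt by auto
  next
    case (Suc n)
    then obtain x where x: "x \<in> carrier G" "act (inv (a [^] n)) (pt \<one> 0) = pt x (- int n * w)"
      by blast
    \<comment> \<open>The point on the next lower level that \<open>a\<close> moves to \<open>pt x (- int n * w)\<close>.\<close>
    define y where "y = (if - int (Suc n) * w < 0 then inv a \<otimes> x else x)"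
    have y: "y \<in> carrier G" using x(1) a by (simp add: y_def)
    have "act a (pt y (- int (Suc n) * w)) = pt x (- int n * w)"
      using x(1) a y act_a[OF y, of "- int (Suc n) * w"]
      by (simp add: y_def inv_solve_left[symmetric] m_assoc[symmetric] algebra_simps)
    then have "act (inv a) (pt x (- int n * w)) = pt y (- int (Suc n) * w)"
      using cancel[OF a pt[OF y]] by metis
    moreover have "inv (a [^] Suc n) = inv a \<otimes> inv (a [^] n)"
      using a by (simp add: inv_mult_group)
    ultimately show ?case using x y a mult[of "inv a" "inv (a [^] n)"] pt by auto
  qed
  have countE: "countable E"
    unfolding E_def using count H by (intro countable_image) (meson countable_subset subgroup.subset)
  have mean: "\<exists>\<mu>. invariant_mean (G\<lparr>carrier := H\<rparr>) E act \<mu>"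
  proof (rule mean_of_asymptotic_translations[where q = "pt \<one>" and p = "int p * w" and \<Omega> = \<Omega>])
    show "inj_on (act g) \<Omega>" if "g \<in> carrier (G\<lparr>carrier := H\<rparr>)" for g
      using that H_carrier cancel by (intro inj_on_inverseI[where g = "act (inv g)"]) auto
    show "range (pt \<one>) \<subseteq> \<Omega>" using pt by auto
    show "\<exists>d J. \<forall>j\<ge>J. act g (pt \<one> j) = pt \<one> (j + d)" if "g \<in> carrier (G\<lparr>carrier := H\<rparr>)" for g
      using high[of g] H_carrier that by (simp, metis one_closed)
    show "pt \<one> (int n * (int p * w)) \<in> E" for n
      using up[of "p * n"] pow[of n] unfolding E_def
      by (intro image_eqI[where x = "a [^] (p * n)"]) (simp_all add: mult_ac)
  qed (use E\<Omega> p(1) w in auto)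
  show ?thesis
  proof (rule countable_action_on_nat[where E = E and act = act])
    show "group (G\<lparr>carrier := H\<rparr>)" using H is_group by (rule subgroup.subgroup_is_group)
    fix x y assume "x \<in> E" "y \<in> E"
    then obtain h k where hk: "h \<in> H" "x = act h (pt \<one> 0)" "k \<in> H" "y = act k (pt \<one> 0)"
      by (auto simp: E_def)
    then have "act (inv h) x = pt \<one> 0" using cancel H_carrier pt by simp
    then have "act (k \<otimes> inv h) x = y"
      using hk mult[of k "inv h" x] H_carrier E\<Omega> \<open>x \<in> E\<close> by auto
    moreover have "k \<otimes> inv h \<in> H"
      using hk subgroup.m_closed[OF H] subgroup.m_inv_closed[OF H] by simp
    ultimately show "\<exists>g\<in>carrier (G\<lparr>carrier := H\<rparr>). act g x = y" by auto
  next
    fix h assume "h \<in> carrier (G\<lparr>carrier := H\<rparr>)" and fix_h: "\<And>x. x \<in> E \<Longrightarrow> act h x = x"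
    then have h: "h \<in> H" "h \<in> carrier G" using H_carrier by auto
    obtain d J where J: "\<And>j x. j \<le> J \<Longrightarrow> x \<in> carrier G \<Longrightarrow> act h (pt x j) = pt (h \<otimes> x) (j + d)"
      using low[OF h(2)] by blast
    define n where "n = nat \<bar>J\<bar>"
    obtain x where x: "x \<in> carrier G" "act (inv (a [^] (p * n))) (pt \<one> 0) = pt x (- int (p * n) * w)"
      using down by blast
    have "\<bar>J\<bar> \<le> int p * \<bar>J\<bar>"
      using p(1) by (simp add: mult_le_cancel_right1)
    also have "\<dots> \<le> int (p * n) * w"
      using w mult_left_mono[of 1 w "int p * \<bar>J\<bar>"] by (simp add: n_def)
    finally have "- int (p * n) * w \<le> J" by simp
    then have "act h (pt x (- int (p * n) * w)) = pt (h \<otimes> x) (- int (p * n) * w + d)"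
      by (intro J x(1))
    moreover have "pt x (- int (p * n) * w) \<in> E"
      unfolding x(2)[symmetric] E_def using pow subgroup.m_inv_closed[OF H] by blast
    ultimately have "h \<otimes> x = x" using fix_h pt_inj by metis
    then show "h = \<one>\<^bsub>G\<lparr>carrier := H\<rparr>\<^esub>" using h(2) x(1) by (simp add: r_cancel_one)
  qed (use countE actE one mult mean E\<Omega> H_carrier in auto)
qed


section \<open>Actions of presented monoids\<close>

text \<open>
  A class acts through an arbitrarily chosen word in it; the relations make the choice irrelevant
  on \<open>\<Omega>\<close> in the locale below. They are only required there because the left multiplications of
  a group are invertible on its carrier alone.
\<close>

definition presented_act ::
  "'x set \<Rightarrow> ('x list \<times> 'x list) set \<Rightarrow> ('x \<Rightarrow> 'e \<Rightarrow> 'e) \<Rightarrow> 'x list set \<Rightarrow> 'e \<Rightarrow> 'e" where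
  "presented_act S R a g = foldr a (SOME u. u \<in> lists S \<and> word_class S R u = g)"

locale presented_action =
  fixes S :: "'x set" and R :: "('x list \<times> 'x list) set" and a :: "'x \<Rightarrow> 'e \<Rightarrow> 'e" and \<Omega> :: "'e set"
  assumes letter_closed: "e \<in> \<Omega> \<Longrightarrow> a l e \<in> \<Omega>"
    and relation: "(u, v) \<in> R \<Longrightarrow> e \<in> \<Omega> \<Longrightarrow> foldr a u e = foldr a v e"
begin

lemma word_closed: "e \<in> \<Omega> \<Longrightarrow> foldr a u e \<in> \<Omega>"
  by (induction u) (simp_all add: letter_closed)

lemma foldr_word_eq: "word_eq R u v \<Longrightarrow> e \<in> \<Omega> \<Longrightarrow> foldr a u e = foldr a v e"
  by (induction arbitrary: e rule: word_eq.induct) (simp_all add: relation word_closed)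

lemma presented_act_word_class:
  assumes "u \<in> lists S" "e \<in> \<Omega>"
  shows "presented_act S R a (word_class S R u) e = foldr a u e"
proof -
  let ?v = "SOME v. v \<in> lists S \<and> word_class S R v = word_class S R u"
  have "?v \<in> lists S \<and> word_class S R ?v = word_class S R u"
    by (rule someI[of _ u]) (simp add: assms(1))
  then have "word_eq R ?v u"
    using word_class_eq_iff[of ?v S u R] assms(1) by blast
  then show ?thesis
    unfolding presented_act_def by (rule foldr_word_eq) (rule assms(2))
qed

lemma presented_act_closed: "e \<in> \<Omega> \<Longrightarrow> presented_act S R a g e \<in> \<Omega>"
  by (simp add: presented_act_def word_closed)

lemma presented_act_one: "e \<in> \<Omega> \<Longrightarrow> presented_act S R a \<one>\<^bsub>presented_monoid S R\<^esub> e = e"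
  using presented_act_word_class[of "[]"] by (simp add: presented_monoid_def)

lemma presented_act_mult:
  assumes "g \<in> carrier (presented_monoid S R)" "h \<in> carrier (presented_monoid S R)" "e \<in> \<Omega>"
  shows "presented_act S R a (g \<otimes>\<^bsub>presented_monoid S R\<^esub> h) e = presented_act S R a g (presented_act S R a h e)"
proof -
  obtain u v where "u \<in> lists S" "g = word_class S R u" "v \<in> lists S" "h = word_class S R v"
    using assms(1,2) by (auto simp: presented_monoid_def)
  then show ?thesis
    using assms(3) presented_act_word_class[of "u @ v" e]
    by (simp add: presented_monoid_mult presented_act_word_class word_closed)
qed

end

section \<open>The two free factors\<close>

abbreviation (input) fe :: "(gen \<times> bool) list \<Rightarrow> (gen \<times> bool) list set" where
  "fe w \<equiv> free_group_elem UNIV w"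

lemma F2_carrier: "carrier F2 = range fe"
  by (simp add: free_group_def presented_monoid_def free_group_elem_def)

lemma fe_mult: "fe u \<otimes>\<^bsub>F2\<^esub> fe v = fe (u @ v)"
  unfolding free_group_def free_group_elem_def by (rule presented_monoid_mult) simp_all

lemma fe_one: "\<one>\<^bsub>F2\<^esub> = fe []"
  by (simp add: free_group_def presented_monoid_def free_group_elem_def)

lemma fe_cancel: "fe [(x, b), (x, \<not> b)] = \<one>\<^bsub>F2\<^esub>"
proof -
  have "word_eq (free_rel UNIV) ([] @ [(x, b), (x, \<not> b)] @ []) ([] @ [] @ [])"
    by (rule word_eq.step) (auto simp: free_rel_def)
  then show ?thesis
    unfolding fe_one free_group_elem_def by (subst word_class_eq_iff) simp_all
qed

abbreviation (input) amalgam_letters where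
  "amalgam_letters \<equiv> carrier F2 <+> carrier F2"

abbreviation (input) double_rel where
  "double_rel c \<equiv> amalgam_rel F2 F2 (generate F2 {fe c}) (\<lambda>x. x)"

definition emb where
  "emb c b X = word_class amalgam_letters (double_rel c) [if b then Inr X else Inl X]"

lemma F2_amalgam_alt: "F2_amalgam c = presented_monoid amalgam_letters (double_rel c)"
  by (simp add: F2_amalgam_def amalgamated_product_def)

lemma amalgam_word_class_eq:
  assumes "(u, v) \<in> double_rel c" "u \<in> lists amalgam_letters" "v \<in> lists amalgam_letters"
  shows "word_class amalgam_letters (double_rel c) u = word_class amalgam_letters (double_rel c) v"
  using assms word_eq.step[OF assms(1), of "[]" "[]"] by (simp add: word_class_eq_iff)

lemma emb_closed: "X \<in> carrier F2 \<Longrightarrow> emb c b X \<in> carrier (F2_amalgam c)"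
  by (auto simp: F2_amalgam_alt presented_monoid_def emb_def intro!: imageI)

lemma emb_mult:
  assumes "X \<in> carrier F2" "Y \<in> carrier F2"
  shows "emb c b X \<otimes>\<^bsub>F2_amalgam c\<^esub> emb c b Y = emb c b (X \<otimes>\<^bsub>F2\<^esub> Y)"
proof -
  interpret F: group F2 by (rule group_free_group)
  have "emb c b X \<otimes>\<^bsub>F2_amalgam c\<^esub> emb c b Y
      = word_class amalgam_letters (double_rel c) (if b then [Inr X, Inr Y] else [Inl X, Inl Y])"
    unfolding F2_amalgam_alt emb_def using assms by (subst presented_monoid_mult) auto
  also have "\<dots> = emb c b (X \<otimes>\<^bsub>F2\<^esub> Y)"
    unfolding emb_def using assms by (cases b; intro amalgam_word_class_eq) (auto simp: amalgam_rel_def)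
  finally show ?thesis .
qed

lemma emb_one: "emb c b \<one>\<^bsub>F2\<^esub> = \<one>\<^bsub>F2_amalgam c\<^esub>"
proof -
  interpret F: group F2 by (rule group_free_group)
  have "emb c b \<one>\<^bsub>F2\<^esub> = word_class amalgam_letters (double_rel c) []"
    unfolding emb_def by (rule amalgam_word_class_eq) (auto simp: amalgam_rel_def)
  then show ?thesis by (simp add: F2_amalgam_alt presented_monoid_def)
qed

lemma emb_amalgamated: "emb c b (fe c) = emb c b' (fe c)"
proof -
  have "emb c False (fe c) = emb c True (fe c)"
    unfolding emb_def using generate.incl[of "fe c" "{fe c}" F2]
    by (intro amalgam_word_class_eq) (auto simp: amalgam_rel_def F2_carrier)
  then show ?thesis by (cases b; cases b'; simp)
qed

lemma countable_F2_amalgam: "countable (carrier (F2_amalgam c))"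
proof -
  have "(UNIV :: gen set) = {Alpha, Beta}" by (auto intro: gen.exhaust)
  then have "countable (UNIV :: gen set)" by (metis countable_finite finite.emptyI finite_insert)
  then have "countable (lists ((UNIV :: gen set) \<times> (UNIV :: bool set)))"
    by (intro countable_lists countable_SIGMA) simp_all
  then have "countable (carrier F2)"
    unfolding free_group_def presented_monoid_def by (simp del: UNIV_Times_UNIV lists_UNIV)
  then show ?thesis
    unfolding F2_amalgam_alt presented_monoid_def by (simp add: Plus_def)
qed


section \<open>Words acting on levels\<close>

fun letter_shift :: "(gen \<Rightarrow> int) \<Rightarrow> gen \<times> bool \<Rightarrow> int" where
  "letter_shift wt (x, b) = (if b then wt x else - wt x)"

definition word_shift :: "(gen \<Rightarrow> int) \<Rightarrow> (gen \<times> bool) list \<Rightarrow> int" where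
  "word_shift wt w = sum_list (map (letter_shift wt) w)"

lemma word_shift_simps [simp]:
  "word_shift wt [] = 0" "word_shift wt (l # w) = letter_shift wt l + word_shift wt w"
  by (simp_all add: word_shift_def)

text \<open>
  The homomorphisms from a free group of rank two to the integers have rank two, and vanishing at
  \<open>w\<close> is one linear condition; a nonzero solution can be given a positive value on one generator.
\<close>

lemma exists_weights_killing:
  obtains wt x where "word_shift wt w = 0" "wt x > 0"
proof -
  define n where "n x = word_shift (\<lambda>y. if y = x then 1 else 0) w" for x
  have lin: "word_shift wt w = wt Alpha * n Alpha + wt Beta * n Beta" for wt
    unfolding n_def
  proof (induction w)
    case (Cons l w)
    obtain x b where l: "l = (x, b)" by fastforce
    show ?case using Cons by (cases x; cases b) (simp_all add: l algebra_simps)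
  qed simp
  show ?thesis
  proof (cases "n Beta = 0")
    case True
    show ?thesis by (rule that[of "\<lambda>x. if x = Beta then 1 else 0" Beta]) (simp_all add: lin True)
  next
    case False
    then have "n Beta * sgn (n Beta) > 0" by (simp flip: abs_sgn)
    then show ?thesis
      by (intro that[of "\<lambda>x. if x = Alpha then \<bar>n Beta\<bar> else - n Alpha * sgn (n Beta)" Alpha])
        (simp_all add: lin abs_sgn)
  qed
qed

text \<open>
  A generator changes the level by its weight. When it acts at a negative level it also multiplies
  by the corresponding element of the group, in the left or the right copy according to the Boolean.
  The inverse letter has to undo this, so it looks at the level that it moves to: that is the test
  on \<open>j - wt x\<close>.
\<close>

fun letter_act where
  "letter_act c wt (x, b) (g, i, j) =
     (if (if b then j else j - wt x) < 0 then emb c i (fe [(x, b)]) \<otimes>\<^bsub>F2_amalgam c\<^esub> g else g,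
      i, j + letter_shift wt (x, b))"

definition double_space where
  "double_space c = carrier (F2_amalgam c) \<times> (UNIV :: bool set) \<times> (UNIV :: int set)"

lemma mem_double_space [simp]: "(g, i, j) \<in> double_space c \<longleftrightarrow> g \<in> carrier (F2_amalgam c)"
  by (simp add: double_space_def)

lemma letter_act_closed: "e \<in> double_space c \<Longrightarrow> letter_act c wt l e \<in> double_space c"
proof -
  assume "e \<in> double_space c"
  moreover obtain x b g i j where "l = (x, b)" "e = (g, i, j)"
    by (metis prod_cases3 surj_pair)
  moreover have "emb c i (fe [(x, b)]) \<in> carrier (F2_amalgam c)" by (simp add: emb_closed F2_carrier)
  ultimately show ?thesis
    using group.is_monoid[OF group_F2_amalgam, THEN monoid.m_closed] by auto
qed

lemma letter_act_cancel:
  assumes "e \<in> double_space c"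
  shows "letter_act c wt (x, b) (letter_act c wt (x, \<not> b) e) = e"
proof -
  interpret G: group "F2_amalgam c" by (rule group_F2_amalgam)
  have F: "fe w \<in> carrier F2" for w by (simp add: F2_carrier)
  have "emb c i (fe [(x, b)]) \<otimes>\<^bsub>F2_amalgam c\<^esub> (emb c i (fe [(x, \<not> b)]) \<otimes>\<^bsub>F2_amalgam c\<^esub> g) = g"
    if "g \<in> carrier (F2_amalgam c)" for i g
    using that emb_closed[OF F]
    by (simp add: G.m_assoc[symmetric] emb_mult[OF F F] fe_mult fe_cancel emb_one)
  moreover obtain g i j where "e = (g, i, j)" by (cases e)
  ultimately show ?thesis
    using assms by (cases b) auto
qed

interpretation F2_act: presented_action "UNIV \<times> UNIV" "free_rel UNIV" "letter_act c wt" "double_space c"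
  for c wt
proof
  fix u v e assume "(u, v) \<in> free_rel (UNIV :: gen set)" and e: "e \<in> double_space c"
  then obtain x b where "u = [(x, b), (x, \<not> b)]" "v = []" by (auto simp: free_rel_def)
  then show "foldr (letter_act c wt) u e = foldr (letter_act c wt) v e"
    using letter_act_cancel[OF e] by simp
qed (rule letter_act_closed)

definition F2_act where
  "F2_act c wt = presented_act (UNIV \<times> UNIV) (free_rel UNIV) (letter_act c wt)"

lemma F2_act_fe: "e \<in> double_space c \<Longrightarrow> F2_act c wt (fe w) e = foldr (letter_act c wt) w e"
  unfolding F2_act_def free_group_elem_def by (rule F2_act.presented_act_word_class) simp

lemma F2_act_closed: "e \<in> double_space c \<Longrightarrow> F2_act c wt X e \<in> double_space c"
  unfolding F2_act_def by (rule F2_act.presented_act_closed)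

lemma F2_act_one: "e \<in> double_space c \<Longrightarrow> F2_act c wt \<one>\<^bsub>F2\<^esub> e = e"
  unfolding F2_act_def free_group_def by (rule F2_act.presented_act_one)

lemma F2_act_mult:
  "X \<in> carrier F2 \<Longrightarrow> Y \<in> carrier F2 \<Longrightarrow> e \<in> double_space c \<Longrightarrow>
     F2_act c wt (X \<otimes>\<^bsub>F2\<^esub> Y) e = F2_act c wt X (F2_act c wt Y e)"
  unfolding F2_act_def free_group_def by (rule F2_act.presented_act_mult)

lemma foldr_letter_act_levels:
  assumes "g \<in> carrier (F2_amalgam c)"
  shows "\<exists>h\<in>carrier (F2_amalgam c). foldr (letter_act c wt) w (g, i, j) = (h, i, j + word_shift wt w)"
proof (induction w)
  case (Cons l w)
  then obtain h where h: "h \<in> carrier (F2_amalgam c)"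
      "foldr (letter_act c wt) w (g, i, j) = (h, i, j + word_shift wt w)"
    by blast
  obtain x b where "l = (x, b)" by fastforce
  then show ?case
    using h letter_act_closed[of "(h, i, j + word_shift wt w)" c wt l] by (auto simp: add_ac)
qed (use assms in simp)

text \<open>
  On its way a word stays within bounded distance of the level where it starts, so it never meets
  the cut at level \<open>0\<close> if it starts high enough, or low enough in the next lemma.
\<close>

lemma foldr_letter_act_high:
  "\<exists>J. \<forall>j\<ge>J. \<forall>i g. foldr (letter_act c wt) w (g, i, j) = (g, i, j + word_shift wt w)"
proof (induction w)
  case (Cons l w)
  then obtain J where J: "\<And>j i g. j \<ge> J \<Longrightarrow> foldr (letter_act c wt) w (g, i, j) = (g, i, j + word_shift wt w)"
    by blast
  obtain x b where l: "l = (x, b)" by fastforce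
  have "foldr (letter_act c wt) (l # w) (g, i, j) = (g, i, j + word_shift wt (l # w))"
    if "j \<ge> max J (\<bar>wt x\<bar> - word_shift wt w)" for j i g
    using that J[of j g i] by (auto simp: l)
  then show ?case by blast
qed simp

lemma foldr_letter_act_low:
  "\<exists>J. \<forall>j\<le>J. \<forall>i. \<forall>g\<in>carrier (F2_amalgam c).
     foldr (letter_act c wt) w (g, i, j) = (emb c i (fe w) \<otimes>\<^bsub>F2_amalgam c\<^esub> g, i, j + word_shift wt w)"
proof -
  interpret G: group "F2_amalgam c" by (rule group_F2_amalgam)
  have F: "fe v \<in> carrier F2" for v by (simp add: F2_carrier)
  show ?thesis
  proof (induction w)
    case Nil
    show ?case by (simp add: fe_one[symmetric] emb_one)
  next
    case (Cons l w)
    then obtain J where J: "\<And>j i g. j \<le> J \<Longrightarrow> g \<in> carrier (F2_amalgam c) \<Longrightarrow> 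
        foldr (letter_act c wt) w (g, i, j) = (emb c i (fe w) \<otimes>\<^bsub>F2_amalgam c\<^esub> g, i, j + word_shift wt w)"
      by blast
    obtain x b where l: "l = (x, b)" by fastforce
    have "foldr (letter_act c wt) (l # w) (g, i, j)
        = (emb c i (fe (l # w)) \<otimes>\<^bsub>F2_amalgam c\<^esub> g, i, j + word_shift wt (l # w))"
      if j: "j \<le> min J (- \<bar>wt x\<bar> - word_shift wt w - 1)" and g: "g \<in> carrier (F2_amalgam c)" for j i g
    proof -
      have "emb c i (fe (l # w)) = emb c i (fe [l]) \<otimes>\<^bsub>F2_amalgam c\<^esub> emb c i (fe w)"
        by (simp add: emb_mult[OF F F] fe_mult)
      then show ?thesis
        using j J[of j g i] g by (auto simp: l G.m_assoc emb_closed[OF F])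
    qed
    then show ?case by blast
  qed
qed

section \<open>The action of the amalgamated product\<close>

text \<open>
  The threshold \<open>T\<close> is so low that \<open>c\<close>, read from there, stays below the cut: it then acts as
  left multiplication by \<open>c\<close>, which is the same element in both copies.
\<close>

locale double_action =
  fixes c :: "(gen \<times> bool) list" and wt :: "gen \<Rightarrow> int" and T :: int
  assumes shift_c: "word_shift wt c = 0"
    and c_below: "j \<le> T \<Longrightarrow> g \<in> carrier (F2_amalgam c) \<Longrightarrow>
      foldr (letter_act c wt) c (g, i, j) = (emb c i (fe c) \<otimes>\<^bsub>F2_amalgam c\<^esub> g, i, j)"
begin

abbreviation "G \<equiv> F2_amalgam c"
abbreviation "\<Omega> \<equiv> double_space c"

fun flip :: "'a \<times> bool \<times> int \<Rightarrow> 'a \<times> bool \<times> int" where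
  "flip (g, i, j) = (g, if j \<le> T then \<not> i else i, j)"

lemma flip_flip [simp]: "flip (flip e) = e"
  by (cases e) auto

lemma flip_closed: "e \<in> \<Omega> \<Longrightarrow> flip e \<in> \<Omega>"
  by (cases e) auto

text \<open>
  Since \<open>c\<close> has weight zero, it preserves every level. Above \<open>T\<close> the flip is trivial, and below
  \<open>T\<close> the word \<open>c\<close> acts by the same multiplication on both copies.
\<close>

lemma flip_commutes_c:
  assumes "e \<in> \<Omega>"
  shows "flip (F2_act c wt (fe c) e) = F2_act c wt (fe c) (flip e)"
proof -
  obtain g i j where e: "e = (g, i, j)" by (cases e)
  then have g: "g \<in> carrier G" using assms by simp
  show ?thesis
  proof (cases "j \<le> T")
    case True
    then show ?thesis
      using flip_closed[OF assms] assms g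
      by (simp add: e F2_act_fe c_below emb_amalgamated[of c "\<not> i" i])
  next
    case False
    then show ?thesis
      using assms foldr_letter_act_levels[OF g, of wt c i j] by (auto simp: e F2_act_fe shift_c)
  qed
qed

lemma flip_commutes:
  assumes "X \<in> generate F2 {fe c}" "e \<in> \<Omega>"
  shows "flip (F2_act c wt X e) = F2_act c wt X (flip e)"
proof -
  interpret F: group F2 by (rule group_free_group)
  have c: "fe c \<in> carrier F2" by (simp add: F2_carrier)
  show ?thesis
    using assms
  proof (induction arbitrary: e rule: generate.induct)
    case one
    then show ?case by (simp add: F2_act_one flip_closed)
  next
    case (incl X)
    then show ?case using flip_commutes_c by simp
  next
    case (inv X)
    \<comment> \<open>The commutation for the inverse follows by applying the one for \<open>c\<close> at the preimage of \<open>e\<close>.\<close>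
    define e' where "e' = F2_act c wt (inv\<^bsub>F2\<^esub> fe c) e"
    have e': "e' \<in> \<Omega>" unfolding e'_def using inv.prems by (rule F2_act_closed)
    have "F2_act c wt (fe c) e' = e"
      using F2_act_mult[OF c _ inv.prems, of "inv\<^bsub>F2\<^esub> fe c" wt] c inv.prems
      by (simp add: e'_def F2_act_one)
    then have "flip e = F2_act c wt (fe c) (flip e')"
      using flip_commutes_c[OF e'] by simp
    then have "F2_act c wt (inv\<^bsub>F2\<^esub> fe c) (flip e) = flip e'"
      using F2_act_mult[of "inv\<^bsub>F2\<^esub> fe c" "fe c" "flip e'" c wt] c flip_closed[OF e']
      by (simp add: F2_act_one)
    then show ?case using inv.hyps by (simp add: e'_def)
  next
    case (eng X Y)
    have "X \<in> carrier F2" "Y \<in> carrier F2"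
      using eng.hyps F.generate_in_carrier[of "{fe c}"] c by auto
    then show ?case
      using eng by (simp add: F2_act_mult F2_act_closed flip_closed)
  qed
qed

text \<open>
  The right factor acts by the conjugate of the action of the left factor under the flip. Below \<open>T\<close>
  this makes it multiply by elements of the right copy at the points whose Boolean is false, and there
  the two factors together act by left multiplication.
\<close>

fun factor_act where
  "factor_act (Inl X) e = F2_act c wt X e"
| "factor_act (Inr X) e = flip (F2_act c wt X (flip e))"

sublocale act: presented_action amalgam_letters "double_rel c" factor_act \<Omega>
proof
  fix l e assume "e \<in> \<Omega>"
  then show "factor_act l e \<in> \<Omega>"
    by (cases l) (simp_all add: F2_act_closed flip_closed)
next
  fix u v e assume uv: "(u, v) \<in> double_rel c" and e: "e \<in> \<Omega>"
  from uv consider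
      x y where "x \<in> carrier F2" "y \<in> carrier F2" "u = [Inl x, Inl y]" "v = [Inl (x \<otimes>\<^bsub>F2\<^esub> y)]"
    | x y where "x \<in> carrier F2" "y \<in> carrier F2" "u = [Inr x, Inr y]" "v = [Inr (x \<otimes>\<^bsub>F2\<^esub> y)]"
    | "u = [Inl \<one>\<^bsub>F2\<^esub>] \<or> u = [Inr \<one>\<^bsub>F2\<^esub>]" "v = []"
    | x where "x \<in> generate F2 {fe c}" "u = [Inl x]" "v = [Inr x]"
    unfolding amalgam_rel_def by blast
  then show "foldr factor_act u e = foldr factor_act v e"
  proof cases
    case (1 x y)
    then show ?thesis using e F2_act_mult[of x y e c wt] by simp
  next
    case (2 x y)
    then show ?thesis using flip_closed[OF e] F2_act_mult[of x y "flip e" c wt] by simp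
  next
    case 3
    then show ?thesis using F2_act_one[OF e, of wt] F2_act_one[OF flip_closed[OF e], of wt] by auto
  next
    case (4 x)
    then show ?thesis using flip_commutes[OF 4(1) flip_closed[OF e]] by simp
  qed
qed

definition act where "act = presented_act amalgam_letters (double_rel c) factor_act"

lemma act_word: "u \<in> lists amalgam_letters \<Longrightarrow> e \<in> \<Omega> \<Longrightarrow>
    act (word_class amalgam_letters (double_rel c) u) e = foldr factor_act u e"
  unfolding act_def by (rule act.presented_act_word_class)

text \<open>
  \<open>f\<close> behaves like an element \<open>g\<close> in the two extremes: a pure translation high up, and a translation
  combined with left multiplication by \<open>g\<close> far down. As composition adds the translation lengths,
  it is enough to verify this for letters.
\<close>

definition translates where
  "translates f g \<longleftrightarrow> (\<exists>d :: int.
     (\<exists>J :: int. \<forall>j\<ge>J. \<forall>x\<in>carrier G. f (x, False, j) = (x, False, j + d)) \<and>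
     (\<exists>J :: int. \<forall>j\<le>J. \<forall>x\<in>carrier G. f (x, False, j) = (g \<otimes>\<^bsub>G\<^esub> x, False, j + d)))"

lemma translatesI:
  fixes J K d :: int
  assumes "\<And>j x. j \<ge> J \<Longrightarrow> x \<in> carrier G \<Longrightarrow> f (x, False, j) = (x, False, j + d)"
    and "\<And>j x. j \<le> K \<Longrightarrow> x \<in> carrier G \<Longrightarrow> f (x, False, j) = (g \<otimes>\<^bsub>G\<^esub> x, False, j + d)"
  shows "translates f g"
  unfolding translates_def
  by (rule exI[of _ d], rule conjI, rule exI[of _ J], simp add: assms(1), rule exI[of _ K], simp add: assms(2))

lemma translates_comp:
  assumes "translates f g" "translates f' g'" "g \<in> carrier G" "g' \<in> carrier G"
  shows "translates (f \<circ> f') (g \<otimes>\<^bsub>G\<^esub> g')"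
proof -
  interpret G: group G by (rule group_F2_amalgam)
  obtain d J K where f: "\<forall>j\<ge>J. \<forall>x\<in>carrier G. f (x, False, j) = (x, False, j + d)"
      "\<forall>j\<le>K. \<forall>x\<in>carrier G. f (x, False, j) = (g \<otimes>\<^bsub>G\<^esub> x, False, j + d)"
    using assms(1) unfolding translates_def by (elim exE conjE)
  obtain d' J' K' where f': "\<forall>j\<ge>J'. \<forall>x\<in>carrier G. f' (x, False, j) = (x, False, j + d')"
      "\<forall>j\<le>K'. \<forall>x\<in>carrier G. f' (x, False, j) = (g' \<otimes>\<^bsub>G\<^esub> x, False, j + d')"
    using assms(2) unfolding translates_def by (elim exE conjE)
  have "(f \<circ> f') (x, False, j) = (x, False, j + (d' + d))"
    if "j \<ge> max J' (J - d')" "x \<in> carrier G" for j x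
    using that f(1)[rule_format, of "j + d'" x] f'(1)[rule_format, of j x] by (simp add: add_ac)
  moreover have "(f \<circ> f') (x, False, j) = (g \<otimes>\<^bsub>G\<^esub> g' \<otimes>\<^bsub>G\<^esub> x, False, j + (d' + d))"
    if "j \<le> min K' (K - d')" "x \<in> carrier G" for j x
    using that f(2)[rule_format, of "j + d'" "g' \<otimes>\<^bsub>G\<^esub> x"] f'(2)[rule_format, of j x] assms(3,4) by (simp add: add_ac G.m_assoc)
  ultimately show ?thesis by (rule translatesI)
qed

lemma translates_factor_act:
  assumes "l \<in> amalgam_letters"
  shows "translates (factor_act l) (word_class amalgam_letters (double_rel c) [l])"
proof -
  obtain w i where l: "l = (if i then Inr (fe w) else Inl (fe w))"
  proof -
    from assms obtain w where "l = Inl (fe w) \<or> l = Inr (fe w)" by (auto simp: F2_carrier)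
    then show ?thesis using that[of False w] that[of True w] by auto
  qed
  then have emb: "word_class amalgam_letters (double_rel c) [l] = emb c i (fe w)"
    by (simp add: emb_def)
  obtain J where J: "\<And>j i g. j \<ge> J \<Longrightarrow> foldr (letter_act c wt) w (g, i, j) = (g, i, j + word_shift wt w)"
    using foldr_letter_act_high by blast
  obtain K where K: "\<And>j i g. j \<le> K \<Longrightarrow> g \<in> carrier G \<Longrightarrow>
      foldr (letter_act c wt) w (g, i, j) = (emb c i (fe w) \<otimes>\<^bsub>G\<^esub> g, i, j + word_shift wt w)"
    using foldr_letter_act_low by blast
  let ?d = "word_shift wt w"
  have "factor_act l (x, False, j) = (x, False, j + ?d)"
    if "j \<ge> max J (T + 1 + \<bar>?d\<bar>)" "x \<in> carrier G" for j x
    using that J[of j x] by (cases i) (auto simp: l F2_act_fe)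
  moreover have "factor_act l (x, False, j) = (emb c i (fe w) \<otimes>\<^bsub>G\<^esub> x, False, j + ?d)"
    if "j \<le> min K (T - \<bar>?d\<bar>)" "x \<in> carrier G" for j x
    using that K[of j x] by (cases i) (auto simp: l F2_act_fe)
  ultimately show ?thesis unfolding emb by (rule translatesI)
qed

lemma translates_act:
  assumes "g \<in> carrier G"
  shows "translates (act g) g"
proof -
  interpret G: group G by (rule group_F2_amalgam)
  have "translates (foldr factor_act u) (word_class amalgam_letters (double_rel c) u)"
    if "u \<in> lists amalgam_letters" for u
    using that
  proof (induction u)
    case Nil
    have "translates id \<one>\<^bsub>G\<^esub>"
      by (rule translatesI[where J = 0 and d = 0 and K = 0]) simp_all
    then show ?case by (simp add: F2_amalgam_alt presented_monoid_def id_def)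
  next
    case (Cons l u)
    have cl: "word_class amalgam_letters (double_rel c) v \<in> carrier G" if "v \<in> lists amalgam_letters" for v
      using that by (simp add: F2_amalgam_alt presented_monoid_def)
    have "word_class amalgam_letters (double_rel c) [l] \<otimes>\<^bsub>G\<^esub> word_class amalgam_letters (double_rel c) u
        = word_class amalgam_letters (double_rel c) ([l] @ u)"
      unfolding F2_amalgam_alt using Cons by (intro presented_monoid_mult) auto
    then show ?case
      using translates_comp[OF translates_factor_act[of l] Cons.IH cl[of "[l]"] cl[of u]] Cons
      by (simp add: comp_def)
  qed
  moreover obtain u where u: "u \<in> lists amalgam_letters" "g = word_class amalgam_letters (double_rel c) u"
    using assms by (auto simp: F2_amalgam_alt presented_monoid_def)
  moreover have "act g e = foldr factor_act u e" if "e \<in> \<Omega>" for e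
    using act_word u that by simp
  ultimately show ?thesis unfolding translates_def by simp
qed

end

theorem theorem20:
  fixes c :: "(gen \<times> bool) list"
    and H :: "((gen \<times> bool) list set + (gen \<times> bool) list set) list set set"
  assumes "subgroup H (F2_amalgam c)"
    and "finite (rcosets\<^bsub>F2_amalgam c\<^esub> H)"
  shows "\<exists>(X :: nat set) \<phi>.
           transitive_action (F2_amalgam c\<lparr>carrier := H\<rparr>) X \<phi> \<and>
           faithful_action (F2_amalgam c\<lparr>carrier := H\<rparr>) X \<phi> \<and>
           amenable_action (F2_amalgam c\<lparr>carrier := H\<rparr>) X \<phi>"
proof -
  obtain wt x where wt: "word_shift wt c = 0" "wt x > 0"
    using exists_weights_killing .
  obtain T where T: "\<And>j i g. j \<le> T \<Longrightarrow> g \<in> carrier (F2_amalgam c) \<Longrightarrow>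
      foldr (letter_act c wt) c (g, i, j) = (emb c i (fe c) \<otimes>\<^bsub>F2_amalgam c\<^esub> g, i, j + word_shift wt c)"
    using foldr_letter_act_low by blast
  interpret double_action c wt T
    using T wt(1) by unfold_locales simp_all
  have x: "fe [(x, True)] \<in> carrier F2" by (simp add: F2_carrier)
  show ?thesis
  proof (rule finite_index_subgroup_action[where G = G and act = act and \<Omega> = \<Omega>
        and pt = "\<lambda>g j. (g, False, j)" and a = "emb c False (fe [(x, True)])" and w = "wt x"])
    show "act g e \<in> \<Omega>" if "g \<in> carrier G" "e \<in> \<Omega>" for g e
      unfolding act_def using that(2) by (rule act.presented_act_closed)
    show "act \<one>\<^bsub>G\<^esub> e = e" if "e \<in> \<Omega>" for e
      unfolding act_def F2_amalgam_alt using that by (rule act.presented_act_one)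
    show "act (g \<otimes>\<^bsub>G\<^esub> h) e = act g (act h e)" if "g \<in> carrier G" "h \<in> carrier G" "e \<in> \<Omega>" for g h e
      using that act.presented_act_mult[of g h e] unfolding act_def F2_amalgam_alt by blast
    show "\<exists>d J. \<forall>j\<ge>J. \<forall>x\<in>carrier G. act g (x, False, j) = (x, False, j + d)" if "g \<in> carrier G" for g
      using translates_act[OF that] unfolding translates_def by metis
    show "\<exists>d J. \<forall>j\<le>J. \<forall>x\<in>carrier G. act g (x, False, j) = (g \<otimes>\<^bsub>G\<^esub> x, False, j + d)" if "g \<in> carrier G" for g
      using translates_act[OF that] unfolding translates_def by metis
    show "emb c False (fe [(x, True)]) \<in> carrier G" by (rule emb_closed[OF x])
    show "act (emb c False (fe [(x, True)])) (g, False, j) =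
        (if j < 0 then emb c False (fe [(x, True)]) \<otimes>\<^bsub>G\<^esub> g else g, False, j + wt x)"
      if "g \<in> carrier G" for g j
    proof -
      have "[Inl (fe [(x, True)])] \<in> lists amalgam_letters" using x by auto
      then have "act (emb c False (fe [(x, True)])) (g, False, j) = letter_act c wt (x, True) (g, False, j)"
        using that act_word[of _ "(g, False, j)"] by (simp add: emb_def F2_act_fe)
      then show ?thesis by simp
    qed
  qed (use assms wt(2) group_F2_amalgam countable_F2_amalgam in simp_all)
qed

end
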